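(* Let $f$, $\mathbf{D}$, $\mathbf{b}$ and $\mathbf{M}$ be as defined in the context. If $\lambda$ is a (possibly complex) eigenvalue of $\mathbf{M}$ and $\lambda \mathbf{I} - \mathbf{D}$ has full rank, then $\mathbf{y} = -(\lambda \mathbf{I} - \mathbf{D})^{-1}\mathbf{b}$ is the unique stationary point of $f$ satisfying $\lambda = \mathbf{y}^T\mathbf{y}$.
   Context: Setting. Let $n,m\ge 1$, let $\mathbf{s}_1,\dots,\mathbf{s}_m\in\mathbb{R}^n$ (senders), $d_1,\dots,d_m\in\mathbb{R}$ (distance measurements), and let $\mathbf{W}=(w_{ij})\in\mathbb{R}^{m\times m}$ be symmetric positive definite. Assume (normalization) that $\sum_{i,j} w_{ij}=1$ and $\sum_{i,j} w_{ij}\mathbf{s}_i=\mathbf{0}$. Define $h:\mathbb{R}^n\to\mathbb{R}$ by $$h(\mathbf{x})=\frac14\sum_{i=1}^m\sum_{j=1}^m w_{ij}\,(\|\mathbf{x}-\mathbf{s}_i\|^2-d_i^2)(\|\mathbf{x}-\mathbf{s}_j\|^2-d_j^2).$$ Then $\nabla h(\mathbf{x})=(\mathbf{x}^T\mathbf{x})\mathbf{x}-\mathbf{A}\mathbf{x}+\mathbf{g}$, where $$\mathbf{A}=-\sum_{i,j}w_{ij}\left(2\mathbf{s}_j\mathbf{s}_i^T+(\mathbf{s}_i^T\mathbf{s}_i-d_i^2)\mathbf{I}\right),\qquad \mathbf{g}=-\sum_{i,j}w_{ij}(\mathbf{s}_i^T\mathbf{s}_i-d_i^2)\mathbf{s}_j,$$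 and $\mathbf{A}$ is real symmetric. Let $\mathbf{Q}$ be an orthogonal matrix such that $\mathbf{D}=\mathbf{Q}^T\mathbf{A}\mathbf{Q}$ is diagonal with $D_{11}\ge D_{22}\ge\dots\ge D_{nn}$, and let $\mathbf{b}=\mathbf{Q}^T\mathbf{g}$. Define $f(\mathbf{y})=h(\mathbf{Q}\mathbf{y})$, so that $$\nabla f(\mathbf{y})=(\mathbf{y}^T\mathbf{y})\mathbf{y}-\mathbf{D}\mathbf{y}+\mathbf{b}.$$ Define the $(2n+1)\times(2n+1)$ real matrix $$\mathbf{M}=\begin{pmatrix}\mathbf{D}&-\operatorname{diag}(\mathbf{b})&\mathbf{0}\\ \mathbf{O}&\mathbf{D}&-\mathbf{b}\\ \mathbf{1}^T&\mathbf{0}^T&0\end{pmatrix},$$ with block sizes $n,n,1$, where $\mathbf{O}$ is the $n\times n$ zero matrix and $\mathbf{1}\in\mathbb{R}^n$ is the all-ones vector. Stationary points are allowed to be complex: a stationary point of $f$ is a $\mathbf{y}\in\mathbb{C}^n$ with $(\mathbf{y}^T\mathbf{y})\mathbf{y}-\mathbf{D}\mathbf{y}+\mathbf{b}=\mathbf{0}$, where $\mathbf{y}^T\mathbf{y}=\sum_k y_k^2$ (no complex conjugation). *)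

theory Defs
  imports "HOL-Analysis.Analysis"
begin

definition sym_pos_def :: "real^'m^'m \<Rightarrow> bool" where
  "sym_pos_def W \<longleftrightarrow> transpose W = W \<and> (\<forall>x. x \<noteq> 0 \<longrightarrow> 0 < x \<bullet> (W *v x))"

definition cost :: "('m::finite \<Rightarrow> real^'n) \<Rightarrow> ('m \<Rightarrow> real) \<Rightarrow> real^'m^'m \<Rightarrow> real^'n \<Rightarrow> real" where
  "cost s d W x = 1/4 * (\<Sum>i\<in>UNIV. \<Sum>j\<in>UNIV.
     W $ i $ j * ((norm (x - s i))\<^sup>2 - (d i)\<^sup>2) * ((norm (x - s j))\<^sup>2 - (d j)\<^sup>2))"

definition outer :: "real^'n \<Rightarrow> real^'n \<Rightarrow> real^'n^'n" where
  "outer u v = (\<chi> k l. u $ k * v $ l)"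

definition A_mat :: "('m::finite \<Rightarrow> real^'n) \<Rightarrow> ('m \<Rightarrow> real) \<Rightarrow> real^'m^'m \<Rightarrow> real^'n^'n" where
  "A_mat s d W = - (\<Sum>i\<in>UNIV. \<Sum>j\<in>UNIV.
     W $ i $ j *\<^sub>R (2 *\<^sub>R outer (s j) (s i) + (s i \<bullet> s i - (d i)\<^sup>2) *\<^sub>R mat 1))"

definition g_vec :: "('m::finite \<Rightarrow> real^'n) \<Rightarrow> ('m \<Rightarrow> real) \<Rightarrow> real^'m^'m \<Rightarrow> real^'n" where
  "g_vec s d W = - (\<Sum>i\<in>UNIV. \<Sum>j\<in>UNIV. (W $ i $ j * (s i \<bullet> s i - (d i)\<^sup>2)) *\<^sub>R s j)"

definition normalized :: "('m::finite \<Rightarrow> real^'n) \<Rightarrow> real^'m^'m \<Rightarrow> bool" where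
  "normalized s W \<longleftrightarrow> (\<Sum>i\<in>UNIV. \<Sum>j\<in>UNIV. W $ i $ j) = 1 \<and>
     (\<Sum>i\<in>UNIV. \<Sum>j\<in>UNIV. W $ i $ j *\<^sub>R s i) = 0"

definition sorted_diagonal :: "real^('n::{finite,linorder})^('n::{finite,linorder}) \<Rightarrow> bool" where
  "sorted_diagonal D \<longleftrightarrow> (\<forall>k l. k \<noteq> l \<longrightarrow> D $ k $ l = 0) \<and> (\<forall>k l. k \<le> l \<longrightarrow> D $ l $ l \<le> D $ k $ k)"

definition block_mat :: "real^'n^'n \<Rightarrow> real^'n \<Rightarrow> real^('n + 'n + unit)^('n + 'n + unit)" where
  "block_mat D b = (\<chi> p q. case p of
       Inl i \<Rightarrow> (case q of Inl j \<Rightarrow> D $ i $ j | Inr (Inl j) \<Rightarrow> (if i = j then - b $ i else 0) | Inr (Inr _) \<Rightarrow> 0)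
     | Inr (Inl i) \<Rightarrow> (case q of Inl j \<Rightarrow> 0 | Inr (Inl j) \<Rightarrow> D $ i $ j | Inr (Inr _) \<Rightarrow> - b $ i)
     | Inr (Inr _) \<Rightarrow> (case q of Inl j \<Rightarrow> 1 | Inr (Inl j) \<Rightarrow> 0 | Inr (Inr _) \<Rightarrow> 0))"

abbreviation cmat :: "real^'n^'m \<Rightarrow> complex^'n^'m" where
  "cmat \<equiv> map_matrix complex_of_real"

definition cvec :: "real^'n \<Rightarrow> complex^'n" where
  "cvec v = (\<chi> k. complex_of_real (v $ k))"

definition eigenvalue :: "'a::field^'n^'n \<Rightarrow> 'a \<Rightarrow> bool" where
  "eigenvalue A l \<longleftrightarrow> (\<exists>v. v \<noteq> 0 \<and> A *v v = l *s v)"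

text \<open>
  Complex zeros of the polynomial map that, on real vectors, is the gradient of
  \<open>\<lambda>y. cost s d W (Q *v y)\<close> (see \<open>real_stationary_point_iff\<close> below). The square
  of \<open>y\<close> is the bilinear one, without conjugation; the type-class inner product of
  \<^typ>\<open>complex^'n\<close> is a different, real-valued form.
\<close>

definition stationary_point :: "real^'n^'n \<Rightarrow> real^'n \<Rightarrow> complex^'n \<Rightarrow> bool" where
  "stationary_point D b y \<longleftrightarrow> scalar_product y y *s y - cmat D *v y + cvec b = 0"

lemma cost_gradient:
  fixes s :: "'m::finite \<Rightarrow> real^'n"
  assumes W: "sym_pos_def W" and N: "normalized s W"
  shows "GDERIV (cost s d W) x :> (x \<bullet> x) *\<^sub>R x - A_mat s d W *v x + g_vec s d W"
proof -
  define r where "r i = (norm (x - s i))\<^sup>2 - (d i)\<^sup>2" for i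
  define c where "c i = s i \<bullet> s i - (d i)\<^sup>2" for i
  have sym: "W $ i $ j = W $ j $ i" for i j
    using W unfolding sym_pos_def_def transpose_def by (metis vec_lambda_beta)
  have N1: "(\<Sum>i\<in>UNIV. \<Sum>j\<in>UNIV. W $ i $ j) = 1"
    and N2: "(\<Sum>i\<in>UNIV. \<Sum>j\<in>UNIV. W $ i $ j *\<^sub>R s i) = 0"
    using N by (auto simp: normalized_def)
  have N3: "(\<Sum>i\<in>UNIV. \<Sum>j\<in>UNIV. W $ i $ j *\<^sub>R s j) = 0"
    using N2 by (subst sum.swap) (simp add: sym[of _ "_"] cong: sum.cong)
  have r: "r i = x \<bullet> x - 2 * (s i \<bullet> x) + c i" for i
    by (simp add: r_def c_def power2_norm_eq_inner inner_diff inner_commute)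
  have d1: "((\<lambda>x. (norm (x - s i))\<^sup>2 - (d i)\<^sup>2) has_derivative (\<lambda>v. 2 * (v \<bullet> (x - s i)))) (at x)" for i
    unfolding power2_norm_eq_inner
    by (auto intro!: derivative_eq_intros simp: inner_commute)
  have "(cost s d W has_derivative
      (\<lambda>v. 1/4 * (\<Sum>i\<in>UNIV. \<Sum>j\<in>UNIV. W $ i $ j * r i * (2 * (v \<bullet> (x - s j)))
          + W $ i $ j * (2 * (v \<bullet> (x - s i))) * r j))) (at x)"
    unfolding cost_def r_def
    by (intro has_derivative_mult_right has_derivative_sum has_derivative_mult d1)
  moreover have "1/4 * (\<Sum>i\<in>UNIV. \<Sum>j\<in>UNIV. W $ i $ j * r i * (2 * (v \<bullet> (x - s j)))
          + W $ i $ j * (2 * (v \<bullet> (x - s i))) * r j)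
      = v \<bullet> (\<Sum>i\<in>UNIV. \<Sum>j\<in>UNIV. (W $ i $ j * r i) *\<^sub>R (x - s j))" for v
  proof -
    have "(\<Sum>i\<in>UNIV. \<Sum>j\<in>UNIV. W $ i $ j * (2 * (v \<bullet> (x - s i))) * r j)
        = (\<Sum>i\<in>UNIV. \<Sum>j\<in>UNIV. W $ i $ j * r i * (2 * (v \<bullet> (x - s j))))"
      by (subst sum.swap, intro sum.cong refl) (simp add: sym mult_ac)
    then show ?thesis
      by (simp add: sum.distrib inner_sum_right sum_distrib_left mult_ac)
  qed
  moreover have "(\<Sum>i\<in>UNIV. \<Sum>j\<in>UNIV. (W $ i $ j * r i) *\<^sub>R (x - s j))
      = (x \<bullet> x) *\<^sub>R x - A_mat s d W *v x + g_vec s d W"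
  proof -
    have o: "outer u v *v x = (v \<bullet> x) *\<^sub>R u" for u v
      by (simp add: vec_eq_iff outer_def matrix_vector_mult_def inner_vec_def sum_distrib_left mult_ac)
    have sv: "(\<Sum>i\<in>I. B i) *v x = (\<Sum>i\<in>I. B i *v x)" if "finite I" for I and B :: "'m \<Rightarrow> real^'n^'n"
      using that by (induction I rule: finite_induct) (auto simp: matrix_vector_mult_add_rdistrib)
    have uv: "(- B) *v x = - (B *v x)" for B :: "real^'n^'n"
      by (simp add: vec_eq_iff matrix_vector_mult_def sum_negf)
    have A: "- (A_mat s d W *v x) = (\<Sum>i\<in>UNIV. \<Sum>j\<in>UNIV.
        W $ i $ j *\<^sub>R ((2 * (s i \<bullet> x)) *\<^sub>R s j + c i *\<^sub>R x))"
      unfolding A_mat_def c_def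
      by (simp add: sv uv o matrix_vector_mult_add_rdistrib scaleR_matrix_vector_assoc[symmetric])
    have e: "(W $ i $ j * r i) *\<^sub>R (x - s j) =
        W $ i $ j *\<^sub>R ((x \<bullet> x) *\<^sub>R x)
        - 2 *\<^sub>R ((W $ i $ j * (s i \<bullet> x)) *\<^sub>R x)
        - (x \<bullet> x) *\<^sub>R (W $ i $ j *\<^sub>R s j)
        + W $ i $ j *\<^sub>R ((2 * (s i \<bullet> x)) *\<^sub>R s j + c i *\<^sub>R x)
        - (W $ i $ j * c i) *\<^sub>R s j" for i j
      by (simp add: r algebra_simps)
    have z1: "(\<Sum>i\<in>UNIV. \<Sum>j\<in>UNIV. W $ i $ j *\<^sub>R ((x \<bullet> x) *\<^sub>R x)) = (x \<bullet> x) *\<^sub>R x"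
      by (simp only: scaleR_left.sum[symmetric] N1 scaleR_one)
    have "(\<Sum>i\<in>UNIV. \<Sum>j\<in>UNIV. W $ i $ j * (s i \<bullet> x)) = (\<Sum>i\<in>UNIV. \<Sum>j\<in>UNIV. W $ i $ j *\<^sub>R s i) \<bullet> x"
      by (simp add: inner_sum_left)
    then have z2: "(\<Sum>i\<in>UNIV. \<Sum>j\<in>UNIV. 2 *\<^sub>R ((W $ i $ j * (s i \<bullet> x)) *\<^sub>R x)) = 0"
      using N2 by (simp flip: scaleR_left.sum scaleR_right.sum del: scaleR_scaleR)
    have z3: "(\<Sum>i\<in>UNIV. \<Sum>j\<in>UNIV. (x \<bullet> x) *\<^sub>R (W $ i $ j *\<^sub>R s j)) = 0"
      using N3 by (simp flip: scaleR_right.sum del: scaleR_scaleR)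
    show ?thesis
      unfolding e sum.distrib sum_subtractf z1 z2 z3 A[symmetric] g_vec_def c_def[symmetric]
      by simp
  qed
  ultimately show ?thesis
    by (simp add: gderiv_def)
qed

lemma rotated_cost_gradient:
  fixes s :: "'m::finite \<Rightarrow> real^'n"
  assumes "sym_pos_def W" "normalized s W" "orthogonal_matrix Q"
    "D = transpose Q ** A_mat s d W ** Q" "b = transpose Q *v g_vec s d W"
  shows "GDERIV (\<lambda>y. cost s d W (Q *v y)) y :> (y \<bullet> y) *\<^sub>R y - D *v y + b"
proof -
  let ?G = "\<lambda>x. (x \<bullet> x) *\<^sub>R x - A_mat s d W *v x + g_vec s d W"
  have "(cost s d W has_derivative (\<lambda>v. v \<bullet> ?G (Q *v y))) (at (Q *v y))"
    using cost_gradient[OF assms(1,2)] by (simp add: gderiv_def)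
  moreover have "((\<lambda>y. Q *v y) has_derivative (\<lambda>v. Q *v v)) (at y)"
    by (simp add: bounded_linear_imp_has_derivative)
  ultimately have "((\<lambda>y. cost s d W (Q *v y)) has_derivative (\<lambda>v. (Q *v v) \<bullet> ?G (Q *v y))) (at y)"
    by (rule has_derivative_compose[rotated])
  moreover have "(Q *v v) \<bullet> ?G (Q *v y) = v \<bullet> ((y \<bullet> y) *\<^sub>R y - D *v y + b)" for v
  proof -
    have "(Q *v y) \<bullet> (Q *v y) = y \<bullet> y"
      using assms(3) orthogonal_transformation_def orthogonal_transformation_matrix
      by (metis matrix_of_matrix_vector_mul matrix_vector_mul_linear)
    moreover have "transpose Q *v (Q *v y) = y"
      using assms(3) by (simp add: matrix_vector_mul_assoc orthogonal_matrix_def)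
    moreover have "(Q *v v) \<bullet> z = v \<bullet> (transpose Q *v z)" for z
      by (metis dot_lmul_matrix inner_commute transpose_matrix_vector)
    ultimately show ?thesis
      by (simp add: assms(4,5) matrix_vector_right_distrib matrix_vector_mult_diff_distrib
          matrix_vector_mult_scaleR matrix_vector_mul_assoc[symmetric]
          del: transpose_matrix_vector)
  qed
  ultimately show ?thesis by (simp add: gderiv_def)
qed

lemma real_stationary_point_iff:
  fixes s :: "'m::finite \<Rightarrow> real^'n"
  assumes "sym_pos_def W" "normalized s W" "orthogonal_matrix Q"
    "D = transpose Q ** A_mat s d W ** Q" "b = transpose Q *v g_vec s d W"
  shows "stationary_point D b (cvec y) \<longleftrightarrow> GDERIV (\<lambda>y. cost s d W (Q *v y)) y :> 0"
proof -
  have "stationary_point D b (cvec y) \<longleftrightarrow> cvec ((y \<bullet> y) *\<^sub>R y - D *v y + b) = 0"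
    unfolding stationary_point_def
    by (simp add: vec_eq_iff cvec_def scalar_product_def inner_vec_def matrix_vector_mult_def
        map_matrix_def)
  also have "\<dots> \<longleftrightarrow> (y \<bullet> y) *\<^sub>R y - D *v y + b = 0"
    unfolding vec_eq_iff cvec_def by (simp only: vec_lambda_beta zero_index of_real_eq_0_iff)
  also have "\<dots> \<longleftrightarrow> GDERIV (\<lambda>y. cost s d W (Q *v y)) y :> 0"
  proof
    assume "(y \<bullet> y) *\<^sub>R y - D *v y + b = 0"
    then show "GDERIV (\<lambda>y. cost s d W (Q *v y)) y :> 0"
      using rotated_cost_gradient[OF assms, of y] by simp
  next
    assume "GDERIV (\<lambda>y. cost s d W (Q *v y)) y :> 0"
    then have "(\<lambda>v. v \<bullet> 0) = (\<lambda>v. v \<bullet> ((y \<bullet> y) *\<^sub>R y - D *v y + b))"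
      using rotated_cost_gradient[OF assms, of y] has_derivative_unique
      unfolding gderiv_def by blast
    then show "(y \<bullet> y) *\<^sub>R y - D *v y + b = 0"
      by (metis inner_eq_zero_iff inner_zero_right)
  qed
  finally show ?thesis .
qed

end

theory Submission
  imports Defs
begin

text \<open>
  When \<open>l = y\<^sup>Ty\<close>, stationarity of \<open>y\<close> is the linear system \<open>(l I - D) y = - b\<close>, which has the
  single solution in the statement. It remains to see that this solution satisfies \<open>y\<^sup>Ty = l\<close>. An
  eigenvector with blocks \<open>(p, q, r)\<close> satisfies \<open>q = r y\<close> and \<open>p\<^sub>k = r y\<^sub>k\<^sup>2\<close>, hence \<open>r \<noteq> 0\<close>, and its
  last row reads \<open>r y\<^sup>Ty = l r\<close>.
\<close>

text \<open>\<open>rank\<close> is the dimension of the row space, so full rank makes the rows span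
  the whole space, and this yields a left inverse.\<close>

lemma full_rank_imp_invertible:
  fixes A :: "'a::field^'n^'n"
  assumes "rank A = CARD('n)"
  shows "invertible A"
proof -
  have "vec.span (rows A) = UNIV"
    using assms vec.dim_eq_full[of "rows A"]
    by (simp add: row_rank_def_gen card_cart_basis vec.dimension_def)
  then show ?thesis
    by (simp add: invertible_left_inverse matrix_left_invertible_span_rows_gen)
qed

lemma invertible_mult_vector_eq_iff:
  fixes A :: "'a::field^'n^'n"
  assumes "invertible A"
  shows "A *v x = c \<longleftrightarrow> x = matrix_inv A *v c"
proof -
  obtain B where "A ** B = mat 1 \<and> B ** A = mat 1"
    using assms by (auto simp: invertible_def)
  \<comment> \<open>\<open>matrix_inv\<close> is a Hilbert choice, so the witness \<open>B\<close>
    is what makes it an actual two-sided inverse.\<close>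
  then have "A ** matrix_inv A = mat 1 \<and> matrix_inv A ** A = mat 1"
    unfolding matrix_inv_def by (rule someI)
  then show ?thesis
    by (metis matrix_vector_mul_assoc matrix_vector_mul_lid)
qed

lemma mat_mult_vector: "mat l *v x = l *s x" for x :: "'a::semiring_1^'n"
  by (simp add: vec_eq_iff matrix_vector_mult_def mat_def if_distrib[of "\<lambda>a. a * _"] cong: if_cong)

text \<open>The only nonlinear term is the cubic one; fixing its scalar factor at \<open>l\<close>
  turns it into \<open>mat l *v y\<close>.\<close>

lemma stationary_point_iff_linear:
  assumes "scalar_product y y = l"
  shows "stationary_point D b y \<longleftrightarrow> (mat l - cmat D) *v y = - cvec b"
  unfolding stationary_point_def assms
  by (simp add: matrix_vector_mult_diff_rdistrib mat_mult_vector eq_neg_iff_add_eq_0)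

lemma sum_UNIV_Plus:
  fixes f :: "'a::finite + 'b::finite \<Rightarrow> 'c::comm_monoid_add"
  shows "sum f UNIV = (\<Sum>i\<in>UNIV. f (Inl i)) + (\<Sum>j\<in>UNIV. f (Inr j))"
  using sum.Plus[of UNIV UNIV f] by (simp add: UNIV_Plus_UNIV)

lemma block_mat_mult_vector:
  fixes v :: "complex^('n::finite + 'n + unit)"
  shows "(cmat (block_mat D b) *v v) $ Inl k
      = (\<Sum>j\<in>UNIV. of_real (D $ k $ j) * v $ Inl j) - of_real (b $ k) * v $ Inr (Inl k)"
    and "(cmat (block_mat D b) *v v) $ Inr (Inl k)
      = (\<Sum>j\<in>UNIV. of_real (D $ k $ j) * v $ Inr (Inl j)) - of_real (b $ k) * v $ Inr (Inr ())"
    and "(cmat (block_mat D b) *v v) $ Inr (Inr ()) = (\<Sum>j\<in>UNIV. v $ Inl j)"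
  by (simp_all add: matrix_vector_mult_def map_matrix_def block_mat_def sum_UNIV_Plus UNIV_unit
      if_distrib[of complex_of_real] if_distrib[of "\<lambda>a. a * _"] cong: if_cong)

text \<open>Here \<open>x\<close> is a function rather than a vector, so that the lemma also covers
  the blocks \<open>v $ Inl j\<close> and \<open>v $ Inr (Inl j)\<close> of an eigenvector.\<close>

lemma diagonal_mult_vector:
  fixes D :: "real^'n^'n"
  assumes "\<And>k j. k \<noteq> j \<Longrightarrow> D $ k $ j = 0"
  shows "(\<Sum>j\<in>UNIV. of_real (D $ k $ j) * x j) = of_real (D $ k $ k) * (x k :: complex)"
proof -
  have "(\<Sum>j\<in>UNIV. of_real (D $ k $ j) * x j) = (\<Sum>j\<in>UNIV. if j = k then of_real (D $ k $ k) * x k else 0)"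
    by (rule sum.cong) (auto simp: assms)
  then show ?thesis
    by simp
qed

text \<open>As \<open>D\<close> is diagonal, the eigenvector equations split into scalar ones with
  factor \<open>l - D $ k $ k\<close>, which invertibility allows to cancel.\<close>

lemma block_mat_eigenvalue_eq_scalar_product:
  fixes D :: "real^'n^'n"
  assumes diag: "\<And>k j. k \<noteq> j \<Longrightarrow> D $ k $ j = 0"
    and eig: "eigenvalue (cmat (block_mat D b)) l"
    and inv: "invertible (mat l - cmat D)"
    and y: "(mat l - cmat D) *v y = - cvec b"
  shows "l = scalar_product y y"
proof -
  define E where "E = mat l - cmat D"
  have E: "(E *v x) $ k = (l - of_real (D $ k $ k)) * x $ k" for x k
  proof -
    have "(cmat D *v x) $ k = of_real (D $ k $ k) * x $ k"
      using diagonal_mult_vector[OF diag, of k "\<lambda>j. x $ j"]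
      by (simp add: matrix_vector_mult_def map_matrix_def)
    then show ?thesis
      by (simp add: E_def matrix_vector_mult_diff_rdistrib mat_mult_vector algebra_simps)
  qed
  have nz: "l - of_real (D $ k $ k) \<noteq> 0" for k
  proof
    assume "l - of_real (D $ k $ k) = 0"
    \<comment> \<open>A vanishing diagonal entry puts the k-th unit vector into the kernel of
      \<open>E\<close>.\<close>
    then have "E *v axis k 1 = E *v 0"
      by (auto simp: vec_eq_iff E axis_def)
    then show False
      using inv invertible_mult_vector_eq_iff[of E] by (metis E_def axis_eq_0_iff zero_neq_one)
  qed
  obtain v where v: "v \<noteq> 0" "cmat (block_mat D b) *v v = l *s v"
    using eig by (auto simp: eigenvalue_def)
  define r where "r = v $ Inr (Inr ())"
  have yk: "(l - of_real (D $ k $ k)) * y $ k = - of_real (b $ k)" for k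
    using y E[of y k] by (simp add: E_def cvec_def)
  have q: "v $ Inr (Inl k) = r * y $ k" for k
  proof -
    \<comment> \<open>This is the second block row; \<open>yk\<close> then replaces
      \<open>- b $ k\<close> by a multiple of the factor to be cancelled.\<close>
    have "(l - of_real (D $ k $ k)) * v $ Inr (Inl k) = - of_real (b $ k) * r"
      using arg_cong[OF v(2), of "\<lambda>u. u $ Inr (Inl k)"]
      by (simp add: block_mat_mult_vector diagonal_mult_vector[OF diag] r_def)
        (simp add: algebra_simps)
    also have "\<dots> = (l - of_real (D $ k $ k)) * (r * y $ k)"
      by (simp flip: yk)
    finally show ?thesis
      using nz by simp
  qed
  have p: "v $ Inl k = r * (y $ k * y $ k)" for k
  proof -
    \<comment> \<open>In the first block row, \<open>diag b\<close> multiplies the middle block;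
      inserting \<open>q\<close> there produces the second factor \<open>y $ k\<close>.\<close>
    have "(l - of_real (D $ k $ k)) * v $ Inl k = - of_real (b $ k) * (r * y $ k)"
      using arg_cong[OF v(2), of "\<lambda>u. u $ Inl k"]
      by (simp add: block_mat_mult_vector diagonal_mult_vector[OF diag] q)
        (simp add: algebra_simps)
    also have "\<dots> = (l - of_real (D $ k $ k)) * (r * (y $ k * y $ k))"
      by (simp flip: yk)
    finally show ?thesis
      using nz by simp
  qed
  have "r \<noteq> 0"
  proof
    assume "r = 0"
    have "v $ i = 0" for i
    proof (cases i)
      case (Inr j)
      with \<open>r = 0\<close> q r_def show ?thesis by (cases j) auto
    qed (simp add: p \<open>r = 0\<close>)
    with v(1) show False by (simp add: vec_eq_iff)
  qed
  moreover have "r * scalar_product y y = r * l"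
    using arg_cong[OF v(2), of "\<lambda>u. u $ Inr (Inr ())"]
    by (simp add: block_mat_mult_vector p r_def scalar_product_def sum_distrib_left mult.commute[of _ l])
  ultimately show ?thesis by simp
qed

theorem mainTheorem1:
  fixes s :: "'m::finite \<Rightarrow> real^('n::{finite,linorder})"
    and d :: "'m \<Rightarrow> real"
    and W :: "real^'m^'m"
    and Q D :: "real^('n::{finite,linorder})^('n::{finite,linorder})"
    and b :: "real^('n::{finite,linorder})"
    and l :: complex
    and y :: "complex^('n::{finite,linorder})"
  assumes "sym_pos_def W"
    and "normalized s W"
    and "orthogonal_matrix Q"
    and "D = transpose Q ** A_mat s d W ** Q"
    and "sorted_diagonal D"
    and "b = transpose Q *v g_vec s d W"
    and "eigenvalue (cmat (block_mat D b)) l"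
    and "rank (mat l - cmat D) = CARD('n)"
    and "y = - (matrix_inv (mat l - cmat D) *v cvec b)"
  shows "stationary_point D b y \<and> l = scalar_product y y \<and>
    (\<forall>z. stationary_point D b z \<and> l = scalar_product z z \<longrightarrow> z = y)"
proof -
  have inv: "invertible (mat l - cmat D)"
    using assms(8) by (rule full_rank_imp_invertible)
  \<comment> \<open>The direction from right to left, at \<open>z = y\<close>, gives existence; the
    other gives uniqueness.\<close>
  have solve: "(mat l - cmat D) *v z = - cvec b \<longleftrightarrow> z = y" for z
    unfolding invertible_mult_vector_eq_iff[OF inv] assms(9) by (simp add: vec.neg)
  have "l = scalar_product y y"
    using assms(5,7) inv solve
    by (intro block_mat_eigenvalue_eq_scalar_product) (auto simp: sorted_diagonal_def)
  then show ?thesis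
    using solve stationary_point_iff_linear by metis
qed

end
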